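(* Let $\lambda\neq 0$ be real, let $\hat F=2\lambda H^*\in\Omega^1_\lambda$, let $\eta=\langle H,X+Y\rangle_{\mathbb C}\subset\mathfrak g_{\mathbb C}$, and let $\mathfrak h=\eta\cap\mathfrak g$. Let $H_0$ be the connected subgroup of $G=SL(2,\mathbb R)$ with Lie algebra $\mathfrak h$, and let $\mathbf H=G_{\hat F}\cdot H_0=H_0\cup\varepsilon H_0$ with $\varepsilon=-I$. Let $U$ be the one-dimensional representation of $H_0$ given by $U(\exp Z)=e^{2\pi i\langle\hat F,Z\rangle}$, $Z\in\mathfrak h$, extended to $\mathbf H$ by either choice $U(\varepsilon)=\pm1$, and let $\rho$ be the natural (complex linear) extension of $dU$ to $\eta$, i.e. $\rho(Z)=2\pi i\langle\hat F,Z\rangle$ for $Z\in\eta$. Then $(\eta,\rho,U)$ (that is, the quadruple $(\eta,\mathfrak h,U,\rho)$) is a complex polarization of the orbit $\Omega^1_\lambda$ at $\hat F$.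
   Context: $\mathfrak g=sl(2,\mathbb R)$ has basis $H=\begin{pmatrix}1&0\\0&-1\end{pmatrix}$, $X=\begin{pmatrix}0&1\\1&0\end{pmatrix}$, $Y=\begin{pmatrix}0&1\\-1&0\end{pmatrix}$ with dual basis $H^*,X^*,Y^*$ of $\mathfrak g^*$; $\mathfrak g_{\mathbb C}=\mathfrak g\otimes_{\mathbb R}\mathbb C$, and $\langle\cdot\rangle_{\mathbb C}$ denotes complex span. The group $G=SL(2,\mathbb R)$ acts on $\mathfrak g^*$ by $\langle K(g)F,Z\rangle=\langle F,\mathrm{Ad}(g^{-1})Z\rangle$, and $\Omega^1_\lambda=\{2xX^*+2hH^*-2yY^*\mid x^2+h^2=y^2+\lambda^2\}$ is a coadjoint orbit. For a Lie group $G$ and $F\in\mathfrak g^*$ with coadjoint orbit $\Omega_F$, let $G_F$ be the stabilizer of $F$, $\mathfrak g_F$ its Lie algebra and $(G_F)_0$ its identity component. A complex polarization of $\Omega_F$ at $F$ is a quadruple $(\eta,\mathfrak h,U,\rho)$, with $\mathfrak h=\eta\cap\mathfrak g$, such that: (1) $\eta$ is a complex subalgebra of $\mathfrak g_{\mathbb C}$ containing $\mathfrak g_F$; (2) $\eta$ is invariant under $\mathrm{Ad}_{\mathfrak g_{\mathbb C}}x$ for all $x\in G_F$; (3) $\eta+\bar\eta$ is the complexification of the real Lie subalgebra $\mathfrak m=(\eta+\bar\eta)\cap\mathfrak g$; (4) the subgroups $M_0,H_0,M,\mathbf H$ are closed, where $M_0$ (resp. $H_0$) is the connected subgroup of $G$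 with Lie algebra $\mathfrak m$ (resp. $\mathfrak h$), $M=G_F\cdot M_0$ and $\mathbf H=G_F\cdot H_0$; (5) $U$ is an irreducible representation of $H_0$ in a Hilbert space whose restriction to $G_F\cap H_0$ is a multiple of $\chi_F$, where $\chi_F(\exp Z)=\exp(2\pi\sqrt{-1}\langle F,Z\rangle)$ on $(G_F)_0\cap H_0$; $\rho$ is the one-dimensional representation $Z\mapsto 2\pi\sqrt{-1}\langle F,Z\rangle$ of $\eta$, and the Nelson condition holds (the integrability condition for Lie algebra representations by operators on a dense domain, namely essential self-adjointness of the sum of squares of the operators representing a basis; automatic for one-dimensional representations); (6) the Pukanszky condition: $F+\eta^\perp\subset\Omega_F$, where $\eta^\perp\subset\mathfrak g^*$ is the set of real functionals whose complex linear extension to $\mathfrak g_{\mathbb C}$ vanishes on $\eta$. *)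

theory Defs
  imports "HOL-Analysis.Analysis"
begin

section \<open>Complex Hilbert spaces and unbounded operators\<close>

class complex_hilbert = banach +
  fixes scaleC :: "complex \<Rightarrow> 'a \<Rightarrow> 'a"  (infixr \<open>*\<^sub>C\<close> 75)
    and cinner :: "'a \<Rightarrow> 'a \<Rightarrow> complex"
  assumes scaleC_add_right: "c *\<^sub>C (x + y) = c *\<^sub>C x + c *\<^sub>C y"
    and scaleC_add_left: "(c + d) *\<^sub>C x = c *\<^sub>C x + d *\<^sub>C x"
    and scaleC_scaleC: "c *\<^sub>C d *\<^sub>C x = (c * d) *\<^sub>C x"
    and scaleC_one: "1 *\<^sub>C x = x"
    and scaleR_scaleC: "r *\<^sub>R x = complex_of_real r *\<^sub>C x"
    and cinner_add_left: "cinner (x + y) z = cinner x z + cinner y z"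
    and cinner_scaleC_left: "cinner (c *\<^sub>C x) y = c * cinner x y"
    and cinner_commute: "cinner y x = cnj (cinner x y)"
    and norm_eq_sqrt_cinner: "norm x = sqrt (Re (cinner x x))"

global_interpretation complex_hilbert: vector_space "scaleC :: complex \<Rightarrow> 'a \<Rightarrow> 'a::complex_hilbert"
  by standard
    (simp_all add: scaleC_add_right scaleC_add_left scaleC_scaleC scaleC_one)

instantiation complex :: complex_hilbert
begin

definition scaleC_complex :: "complex \<Rightarrow> complex \<Rightarrow> complex"
  where "scaleC_complex c z = c * z"

definition cinner_complex :: "complex \<Rightarrow> complex \<Rightarrow> complex"
  where "cinner_complex z w = z * cnj w"

instance
proof
  fix x :: complex
  show "norm x = sqrt (Re (cinner x x))"
    by (simp add: cinner_complex_def cmod_def power2_eq_square)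
qed (simp_all add: scaleC_complex_def cinner_complex_def algebra_simps scaleR_conv_of_real)

end

text \<open>Densely defined operators are handled through their graphs.  Essentially self-adjoint: densely
  defined with self-adjoint closure.\<close>

definition adjoint_graph :: "('v::complex_hilbert \<times> 'v) set \<Rightarrow> ('v \<times> 'v) set"
  where "adjoint_graph T = {(y, z). \<forall>(x, w) \<in> T. cinner w y = cinner x z}"

definition essentially_selfadjoint :: "'v::complex_hilbert set \<Rightarrow> ('v \<Rightarrow> 'v) \<Rightarrow> bool"
  where "essentially_selfadjoint D A \<longleftrightarrow>
    complex_hilbert.subspace D \<and> closure D = UNIV \<and>
    (\<forall>v\<in>D. \<forall>w\<in>D. A (v + w) = A v + A w) \<and> (\<forall>c. \<forall>v\<in>D. A (c *\<^sub>C v) = c *\<^sub>C A v) \<and>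
    (let T = closure {(v, A v) | v. v \<in> D} in adjoint_graph T = T)"

section \<open>Linear Lie groups\<close>

definition linear_lie_group :: "(real^'n^'n) set \<Rightarrow> bool"
  where "linear_lie_group G \<longleftrightarrow>
    mat 1 \<in> G \<and> (\<forall>g\<in>G. \<forall>k\<in>G. g ** k \<in> G) \<and>
    (\<forall>g\<in>G. invertible g \<and> matrix_inv g \<in> G) \<and>
    closedin (top_of_set {g. invertible g}) G"

definition mexp :: "real^'n^'n \<Rightarrow> real^'n^'n"
  where "mexp A = (\<Sum>k. (1 / fact k) *\<^sub>R ((**) A ^^ k) (mat 1))"

text \<open>Only meaningful for closed subgroups of the general linear group.\<close>

definition lie_algebra :: "(real^'n^'n) set \<Rightarrow> (real^'n^'n) set"
  where "lie_algebra G = {Z. \<forall>t. mexp (t *\<^sub>R Z) \<in> G}"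

definition bracket :: "'a::ring_1^'n^'n \<Rightarrow> 'a^'n^'n \<Rightarrow> 'a^'n^'n"
  where "bracket A B = A ** B - B ** A"

definition real_subalgebra :: "(real^'n^'n) set \<Rightarrow> bool"
  where "real_subalgebra \<aa> \<longleftrightarrow> subspace \<aa> \<and> (\<forall>Z\<in>\<aa>. \<forall>W\<in>\<aa>. bracket Z W \<in> \<aa>)"

text \<open>The connected Lie subgroup with Lie algebra \<open>\<aa>\<close> (its analytic subgroup), i.e. the subgroup
  generated by \<open>exp \<aa>\<close>.  Closure under inverses is automatic because \<open>\<aa> = -\<aa>\<close>.\<close>

inductive_set connected_subgroup :: "(real^'n^'n) set \<Rightarrow> (real^'n^'n) set"
  for \<aa> :: "(real^'n^'n) set"
  where
    one: "mat 1 \<in> connected_subgroup \<aa>"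
  | mult: "Z \<in> \<aa> \<Longrightarrow> g \<in> connected_subgroup \<aa> \<Longrightarrow> mexp Z ** g \<in> connected_subgroup \<aa>"

definition set_mult :: "(real^'n^'n) set \<Rightarrow> (real^'n^'n) set \<Rightarrow> (real^'n^'n) set"
  where "set_mult A B = {a ** b | a b. a \<in> A \<and> b \<in> B}"

definition Ad :: "'a::field^'n^'n \<Rightarrow> 'a^'n^'n \<Rightarrow> 'a^'n^'n"
  where "Ad g Z = g ** Z ** matrix_inv g"

section \<open>Coadjoint orbits\<close>

text \<open>A functional on a subspace \<open>\<aa>\<close> of the matrices is represented by its extensional extension, so
  that equality of functionals is equality on \<open>\<aa>\<close>.\<close>

definition dual :: "(real^'n^'n) set \<Rightarrow> (real^'n^'n \<Rightarrow> real) set"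
  where "dual \<aa> = {F \<in> extensional \<aa>.
    (\<forall>Z\<in>\<aa>. \<forall>W\<in>\<aa>. F (Z + W) = F Z + F W) \<and> (\<forall>c. \<forall>Z\<in>\<aa>. F (c *\<^sub>R Z) = c * F Z)}"

definition coadjoint :: "(real^'n^'n) set \<Rightarrow> real^'n^'n \<Rightarrow> (real^'n^'n \<Rightarrow> real) \<Rightarrow> (real^'n^'n \<Rightarrow> real)"
  where "coadjoint G g F = (\<lambda>Z\<in>lie_algebra G. F (Ad (matrix_inv g) Z))"

definition coadjoint_orbit :: "(real^'n^'n) set \<Rightarrow> (real^'n^'n \<Rightarrow> real) \<Rightarrow> (real^'n^'n \<Rightarrow> real) set"
  where "coadjoint_orbit G F = (\<lambda>g. coadjoint G g F) ` G"

definition stabilizer :: "(real^'n^'n) set \<Rightarrow> (real^'n^'n \<Rightarrow> real) \<Rightarrow> (real^'n^'n) set"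
  where "stabilizer G F = {g \<in> G. coadjoint G g F = F}"

section \<open>Complexification\<close>

definition cscale :: "complex \<Rightarrow> complex^'n^'n \<Rightarrow> complex^'n^'n"
  where "cscale c A = map_matrix ((*) c) A"

global_interpretation cmat: vector_space "cscale :: complex \<Rightarrow> complex^'n^'n \<Rightarrow> complex^'n^'n"
  by standard (simp_all add: cscale_def map_matrix_def vec_eq_iff algebra_simps)

definition cplx :: "real^'n^'n \<Rightarrow> complex^'n^'n"
  where "cplx A = map_matrix complex_of_real A"

definition complexification :: "(real^'n^'n) set \<Rightarrow> (complex^'n^'n) set"
  where "complexification \<aa> = {cplx A + cscale \<i> (cplx B) | A B. A \<in> \<aa> \<and> B \<in> \<aa>}"

definition complex_subalgebra :: "(complex^'n^'n) set \<Rightarrow> bool"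
  where "complex_subalgebra \<eta> \<longleftrightarrow> cmat.subspace \<eta> \<and> (\<forall>Z\<in>\<eta>. \<forall>W\<in>\<eta>. bracket Z W \<in> \<eta>)"

text \<open>\<open>S \<inter> \<aa>\<close>, with \<open>\<aa>\<close> embedded in its complexification.\<close>

definition real_points :: "(real^'n^'n) set \<Rightarrow> (complex^'n^'n) set \<Rightarrow> (real^'n^'n) set"
  where "real_points \<aa> S = {Z \<in> \<aa>. cplx Z \<in> S}"

definition sum_conj :: "(complex^'n^'n) set \<Rightarrow> (complex^'n^'n) set"
  where "sum_conj \<eta> = {Z + map_matrix cnj W | Z W. Z \<in> \<eta> \<and> W \<in> \<eta>}"

definition cext :: "(real^'n^'n \<Rightarrow> real) \<Rightarrow> complex^'n^'n \<Rightarrow> complex"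
  where "cext F W = complex_of_real (F (map_matrix Re W)) + \<i> * complex_of_real (F (map_matrix Im W))"

definition annihilator :: "(real^'n^'n) set \<Rightarrow> (complex^'n^'n) set \<Rightarrow> (real^'n^'n \<Rightarrow> real) set"
  where "annihilator \<aa> \<eta> = {P \<in> dual \<aa>. \<forall>W\<in>\<eta>. cext P W = 0}"

section \<open>Representations\<close>

definition hilbert_rep :: "(real^'n^'n) set \<Rightarrow> (real^'n^'n \<Rightarrow> 'v::complex_hilbert \<Rightarrow> 'v) \<Rightarrow> bool"
  where "hilbert_rep K U \<longleftrightarrow>
    (\<forall>g\<in>K. bounded_linear (U g) \<and> (\<forall>c v. U g (c *\<^sub>C v) = c *\<^sub>C U g v)) \<and>
    U (mat 1) = id \<and> (\<forall>g\<in>K. \<forall>k\<in>K. U (g ** k) = U g \<circ> U k) \<and>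
    (\<forall>v. continuous_on K (\<lambda>g. U g v))"

definition irreducible_rep :: "(real^'n^'n) set \<Rightarrow> (real^'n^'n \<Rightarrow> 'v::complex_hilbert \<Rightarrow> 'v) \<Rightarrow> bool"
  where "irreducible_rep K U \<longleftrightarrow>
    hilbert_rep K U \<and> (\<exists>v::'v. v \<noteq> 0) \<and>
    (\<forall>W. complex_hilbert.subspace W \<and> closed W \<and> (\<forall>g\<in>K. U g ` W \<subseteq> W) \<longrightarrow> W = {0} \<or> W = UNIV)"

definition unitary_character :: "(real^'n^'n) set \<Rightarrow> (real^'n^'n \<Rightarrow> complex) \<Rightarrow> bool"
  where "unitary_character K chi \<longleftrightarrow>
    (\<forall>g\<in>K. norm (chi g) = 1) \<and> (\<forall>g\<in>K. \<forall>k\<in>K. chi (g ** k) = chi g * chi k) \<and> continuous_on K chi"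

definition one_dim_lie_rep :: "(complex^'n^'n) set \<Rightarrow> (complex^'n^'n \<Rightarrow> complex) \<Rightarrow> bool"
  where "one_dim_lie_rep \<eta> \<rho> \<longleftrightarrow>
    (\<forall>Z\<in>\<eta>. \<forall>W\<in>\<eta>. \<rho> (Z + W) = \<rho> Z + \<rho> W) \<and> (\<forall>c. \<forall>Z\<in>\<eta>. \<rho> (cscale c Z) = c * \<rho> Z) \<and>
    (\<forall>Z\<in>\<eta>. \<forall>W\<in>\<eta>. \<rho> (bracket Z W) = \<rho> Z * \<rho> W - \<rho> W * \<rho> Z)"

text \<open>Nelson's integrability condition for a representation \<open>\<pi>\<close> of a real Lie algebra \<open>\<aa>\<close> by operators
  on the common dense invariant domain \<open>D\<close>.\<close>

definition nelson_condition ::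
  "(real^'n^'n) set \<Rightarrow> 'v::complex_hilbert set \<Rightarrow> (real^'n^'n \<Rightarrow> 'v \<Rightarrow> 'v) \<Rightarrow> bool"
  where "nelson_condition \<aa> D \<pi> \<longleftrightarrow>
    closure D = UNIV \<and> (\<forall>Z\<in>\<aa>. \<pi> Z ` D \<subseteq> D) \<and>
    (\<forall>B. independent B \<and> span B = \<aa> \<longrightarrow> essentially_selfadjoint D (\<lambda>v. \<Sum>b\<in>B. \<pi> b (\<pi> b v)))"

section \<open>Complex polarizations\<close>

text \<open>\<open>chi\<close> plays the role of the character \<open>\<chi>\<^sub>F\<close>.  The representation \<open>\<rho>\<close> of the complex algebra \<open>\<eta>\<close>
  acts on \<open>\<complex>\<close> by multiplication; Nelson's condition concerns real Lie algebras, hence is imposed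
  on its restriction to \<open>\<hh>\<close>.\<close>

definition complex_polarization ::
  "(real^'n^'n) set \<Rightarrow> (real^'n^'n \<Rightarrow> real) set \<Rightarrow> (real^'n^'n \<Rightarrow> real) \<Rightarrow>
   (complex^'n^'n) set \<Rightarrow> (real^'n^'n) set \<Rightarrow> (real^'n^'n \<Rightarrow> 'v::complex_hilbert \<Rightarrow> 'v) \<Rightarrow>
   (complex^'n^'n \<Rightarrow> complex) \<Rightarrow> bool"
  where "complex_polarization G \<Omega> F \<eta> \<hh> U \<rho> \<longleftrightarrow>
   (let \<gg> = lie_algebra G; GF = stabilizer G F; \<gg>F = lie_algebra GF;
        \<mm> = real_points \<gg> (sum_conj \<eta>);
        M0 = connected_subgroup \<mm>; H0 = connected_subgroup \<hh>
    in linear_lie_group G \<and> F \<in> dual \<gg> \<and> \<Omega> = coadjoint_orbit G F \<and> \<hh> = real_points \<gg> \<eta> \<and>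
      complex_subalgebra \<eta> \<and> \<eta> \<subseteq> complexification \<gg> \<and> cplx ` \<gg>F \<subseteq> \<eta> \<and>
      (\<forall>x\<in>GF. Ad (cplx x) ` \<eta> \<subseteq> \<eta>) \<and>
      real_subalgebra \<mm> \<and> sum_conj \<eta> = complexification \<mm> \<and>
      (\<forall>S \<in> {M0, H0, set_mult GF M0, set_mult GF H0}. closedin (top_of_set G) S) \<and>
      irreducible_rep H0 U \<and>
      (\<exists>chi. unitary_character GF chi \<and>
         (\<forall>Z\<in>\<gg>F. mexp Z \<in> connected_component_set GF (mat 1) \<inter> H0 \<longrightarrow>
            chi (mexp Z) = exp (2 * pi * \<i> * F Z)) \<and>
         (\<forall>g \<in> GF \<inter> H0. \<forall>v. U g v = chi g *\<^sub>C v)) \<and>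
      one_dim_lie_rep \<eta> \<rho> \<and> (\<forall>Z\<in>\<eta>. \<rho> Z = 2 * pi * \<i> * cext F Z) \<and>
      nelson_condition \<hh> UNIV (\<lambda>Z z. \<rho> (cplx Z) * z) \<and>
      (\<forall>P \<in> annihilator \<gg> \<eta>. (\<lambda>Z\<in>\<gg>. F Z + P Z) \<in> \<Omega>))"

section \<open>The group \<open>SL(2, \<real>)\<close>\<close>

definition SL2 :: "(real^2^2) set"
  where "SL2 = {g. det g = 1}"

definition sl2 :: "(real^2^2) set"
  where "sl2 = lie_algebra SL2"

definition mH :: "real^2^2" where "mH = vector [vector [1, 0], vector [0, - 1]]"
definition mX :: "real^2^2" where "mX = vector [vector [0, 1], vector [1, 0]]"
definition mY :: "real^2^2" where "mY = vector [vector [0, 1], vector [- 1, 0]]"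

text \<open>The element of the dual basis of \<open>mH, mX, mY\<close> corresponding to \<open>b\<close>.\<close>

definition dual_basis :: "real^2^2 \<Rightarrow> real^2^2 \<Rightarrow> real"
  where "dual_basis b = (\<lambda>Z\<in>sl2. representation {mH, mX, mY} Z b)"

definition Omega1 :: "real \<Rightarrow> (real^2^2 \<Rightarrow> real) set"
  where "Omega1 lam =
    {(\<lambda>Z\<in>sl2. 2 * x * dual_basis mX Z + 2 * h * dual_basis mH Z - 2 * y * dual_basis mY Z) | x h y.
      x\<^sup>2 + h\<^sup>2 = y\<^sup>2 + lam\<^sup>2}"

definition F_hat :: "real \<Rightarrow> real^2^2 \<Rightarrow> real"
  where "F_hat lam = (\<lambda>Z\<in>sl2. 2 * lam * dual_basis mH Z)"

definition eta :: "(complex^2^2) set"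
  where "eta = cmat.span {cplx mH, cplx (mX + mY)}"

definition frak_h :: "(real^2^2) set"
  where "frak_h = real_points sl2 eta"

definition H_0 :: "(real^2^2) set"
  where "H_0 = connected_subgroup frak_h"

definition H_bold :: "real \<Rightarrow> (real^2^2) set"
  where "H_bold lam = set_mult (stabilizer SL2 (F_hat lam)) H_0"

definition epsilon :: "real^2^2"
  where "epsilon = - mat 1"

text \<open>\<open>U\<close> is a one-dimensional representation of \<open>\<^bold>H\<close> extending \<open>exp Z \<mapsto> e\<^bsup>2\<pi>i\<langle>F,Z\<rangle>\<^esup>\<close>, with
  \<open>U \<epsilon> = s\<close>.\<close>

definition extends_U :: "real \<Rightarrow> complex \<Rightarrow> (real^2^2 \<Rightarrow> complex) \<Rightarrow> bool"
  where "extends_U lam s U \<longleftrightarrow>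
    hilbert_rep (H_bold lam) (\<lambda>g z. U g * z) \<and>
    (\<forall>Z\<in>frak_h. U (mexp Z) = exp (2 * pi * \<i> * F_hat lam Z)) \<and> U epsilon = s"

end

theory Submission
  imports Defs
begin

text \<open>In terms of matrix entries everything in the statement becomes explicit. The algebra \<open>eta\<close> consists
  of the traceless upper triangular matrices, and the functional \<open>F_hat lam\<close> is \<open>Z \<mapsto> 2 lam Z\<^sub>1\<^sub>1\<close>. Its
  stabilizer is the group of diagonal matrices of determinant \<open>1\<close>, with Lie algebra inside \<open>\<real> H\<close>. The
  group \<open>H_0\<close> consists of the upper triangular matrices of determinant \<open>1\<close> with positive diagonal, and
  \<open>\<^bold>H\<close> of those with arbitrary diagonal. All these sets are given by closed conditions in \<open>SL2\<close>.
  
  The algebra \<open>eta\<close> is stable under conjugation by diagonal matrices and under complex conjugation, so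
  it polarizes with \<open>\<mm> = \<hh>\<close>. The functional vanishes on the commutator \<open>[eta, eta]\<close>, which is strictly
  upper triangular; hence \<open>2\<pi>i F_hat\<close> is a representation of \<open>eta\<close>. It integrates to the character
  \<open>|g\<^sub>1\<^sub>1|\<^bsup>4\<pi>i lam\<^esup>\<close> of \<open>H_0\<close>, and the element \<open>epsilon\<close>, central of order two, leaves a choice of sign on
  \<open>\<^bold>H\<close>. Irreducibility and the Nelson condition hold since the representations are one-dimensional and the
  functional is real.
  
  What remains is the geometry of the orbit. Writing a functional as
  \<open>Z \<mapsto> p Z\<^sub>1\<^sub>1 + q Z\<^sub>1\<^sub>2 + r Z\<^sub>2\<^sub>1\<close>, the set \<open>Omega1 lam\<close> is the one-sheeted hyperboloid
  \<open>p\<^sup>2 + 4 q r = 4 lam\<^sup>2\<close>. Solving for a matrix that carries \<open>F_hat lam\<close> to a given point shows that it is a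
  single orbit (\<open>coadjoint_orbit_F_hat\<close>). The functionals vanishing on \<open>eta\<close> translate \<open>F_hat lam\<close> along a
  line of the hyperboloid, which is the Pukanszky condition (\<open>pukanszky\<close>).
  
  The analytic input concerns the exponential series: it converges entrywise, it can be differentiated
  at the origin, which bounds Lie algebras from above, and traceless matrices have exponentials of
  determinant \<open>1\<close> (\<open>det_mexp_traceless\<close>), so that \<open>sl2\<close> is exactly the space of traceless matrices.\<close>

section \<open>Two-by-two matrices\<close>

text \<open>Used like a datatype constructor: every matrix has this form, and on such terms products, inverses
  and determinants are computed by rewriting, which keeps index sums out of most later proofs.\<close>

definition mat2 :: "'a \<Rightarrow> 'a \<Rightarrow> 'a \<Rightarrow> 'a \<Rightarrow> 'a::zero^2^2"
  where "mat2 a b c d = vector [vector [a, b], vector [c, d]]"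

lemma mat2_nth [simp]:
  "mat2 a b c d $ 1 $ 1 = a" "mat2 a b c d $ 1 $ 2 = b"
  "mat2 a b c d $ 2 $ 1 = c" "mat2 a b c d $ 2 $ 2 = d"
  by (simp_all add: mat2_def)

lemma eq_mat2_iff: "A = mat2 a b c d \<longleftrightarrow> A $ 1 $ 1 = a \<and> A $ 1 $ 2 = b \<and> A $ 2 $ 1 = c \<and> A $ 2 $ 2 = d"
  by (auto simp: vec_eq_iff forall_2)

lemma mat2_inject [simp]: "mat2 a b c d = mat2 a' b' c' d' \<longleftrightarrow> a = a' \<and> b = b' \<and> c = c' \<and> d = d'"
  by (auto simp: eq_mat2_iff)

lemma mat2_cases [cases type]:
  obtains a b c d where "A = mat2 a b c d"
  using eq_mat2_iff by blast

lemma mat2_mult [simp]: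
  "mat2 a b c d ** mat2 a' b' c' d' =
   mat2 (a * a' + b * c') (a * b' + b * d') (c * a' + d * c') (c * b' + d * (d'::'a::semiring_1))"
  by (simp add: eq_mat2_iff matrix_matrix_mult_def sum_2)

lemma mat2_add [simp]:
  "mat2 a b c d + mat2 a' b' c' d' = mat2 (a + a') (b + b') (c + c') (d + (d'::'a::monoid_add))"
  by (simp add: eq_mat2_iff)

lemma mat2_diff [simp]:
  "mat2 a b c d - mat2 a' b' c' d' = mat2 (a - a') (b - b') (c - c') (d - (d'::'a::group_add))"
  by (simp add: eq_mat2_iff)

lemma mat2_scaleR [simp]: "r *\<^sub>R mat2 a b c d = mat2 (r *\<^sub>R a) (r *\<^sub>R b) (r *\<^sub>R c) (r *\<^sub>R (d::'a::real_vector))"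
  by (simp add: eq_mat2_iff)

lemma mat2_cscale [simp]: "cscale r (mat2 a b c d) = mat2 (r * a) (r * b) (r * c) (r * d)"
  by (simp add: eq_mat2_iff cscale_def map_matrix_def)

lemma mat2_map [simp]: "map_matrix f (mat2 a b c d) = mat2 (f a) (f b) (f c) (f d)"
  by (simp add: eq_mat2_iff map_matrix_def)

lemma mat2_cplx [simp]: "cplx (mat2 a b c d) = mat2 (of_real a) (of_real b) (of_real c) (of_real d)"
  by (simp add: cplx_def)

lemma mat_1_eq_mat2: "mat 1 = mat2 1 0 0 (1::'a::zero_neq_one)"
  by (simp add: eq_mat2_iff mat_def)

lemma zero_eq_mat2: "0 = mat2 0 0 0 0"
  by (simp add: eq_mat2_iff)

lemma det_mat2 [simp]: "det (mat2 a b c d) = a * d - b * c"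
  by (simp add: det_2)

lemma matrix_inv_mat2:
  fixes a b c d :: "'a::field"
  assumes "a * d - b * c = 1"
  shows "invertible (mat2 a b c d)" "matrix_inv (mat2 a b c d) = mat2 d (- b) (- c) a"
proof -
  have *: "mat2 a b c d ** mat2 d (- b) (- c) a = mat 1" "mat2 d (- b) (- c) a ** mat2 a b c d = mat 1"
    using assms by (simp_all add: mat_1_eq_mat2 algebra_simps)
  then show inv: "invertible (mat2 a b c d)" unfolding invertible_def by blast
  show "matrix_inv (mat2 a b c d) = mat2 d (- b) (- c) a"
    unfolding matrix_inv_def
  proof (rule some_equality)
    fix B assume "mat2 a b c d ** B = mat 1 \<and> B ** mat2 a b c d = mat 1"
    then show "B = mat2 d (- b) (- c) a"
      using * by (metis matrix_mul_assoc matrix_mul_lid matrix_mul_rid)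
  qed (use * in blast)
qed

section \<open>The matrix exponential\<close>

lemma mpow_scaleR:
  fixes Z :: "real^'n^'n"
  shows "(((**) (t *\<^sub>R Z)) ^^ k) (mat 1) = t ^ k *\<^sub>R (((**) Z) ^^ k) (mat 1)"
proof (induction k)
  case (Suc k)
  have "(((**) (t *\<^sub>R Z)) ^^ Suc k) (mat 1) = (t *\<^sub>R Z) ** (t ^ k *\<^sub>R (((**) Z) ^^ k) (mat 1))"
    by (simp only: funpow.simps o_apply Suc)
  also have "\<dots> = t ^ Suc k *\<^sub>R (((**) Z) ^^ Suc k) (mat 1)"
    by (simp add: matrix_scalar_ac mult.commute flip: scalar_matrix_assoc)
  finally show ?case .
qed simp

text \<open>A bound geometric in the exponent: after division by \<open>k!\<close> it is summable, so the exponential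
  series may be summed entry by entry. The crude constant \<open>n max |Z\<^sub>i\<^sub>j|\<close> suffices.\<close>

lemma mpow_entry_bound:
  fixes Z :: "real^'n^'n"
  obtains M where "\<And>k i j. \<bar>(((**) Z) ^^ k) (mat 1) $ i $ j\<bar> \<le> M ^ k"
proof
  define c where "c = Max (range (\<lambda>(i, j). \<bar>Z $ i $ j\<bar>))"
  have c: "\<bar>Z $ i $ j\<bar> \<le> c" for i j
    unfolding c_def by (rule Max_ge) (auto intro: rev_image_eqI[of "(i, j)"])
  then have c0: "0 \<le> c" by (meson abs_ge_zero order_trans)
  show "\<bar>(((**) Z) ^^ k) (mat 1) $ i $ j\<bar> \<le> (real CARD('n) * c) ^ k" for k i j
  proof (induction k arbitrary: i j)
    case 0
    then show ?case by (simp add: mat_def)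
  next
    case (Suc k)
    have "\<bar>(((**) Z) ^^ Suc k) (mat 1) $ i $ j\<bar> \<le> (\<Sum>l\<in>UNIV. \<bar>Z $ i $ l * (((**) Z) ^^ k) (mat 1) $ l $ j\<bar>)"
      by (simp add: matrix_matrix_mult_def sum_abs)
    also have "\<dots> \<le> (\<Sum>l\<in>(UNIV::'n set). c * (real CARD('n) * c) ^ k)"
      unfolding abs_mult by (intro sum_mono mult_mono c Suc c0) auto
    finally show ?case by (simp add: mult_ac)
  qed
qed

text \<open>The sum that defines \<open>mexp\<close> is a limit of matrices; every later computation of an exponential
  rests on the fact that it can be read off in each entry separately.\<close>

lemma mexp_nth_sums:
  fixes Z :: "real^'n^'n"
  shows "(\<lambda>k. (((**) Z) ^^ k) (mat 1) $ i $ j / fact k) sums (mexp Z $ i $ j)"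
proof -
  obtain M where M: "\<And>k i j. \<bar>(((**) Z) ^^ k) (mat 1) $ i $ j\<bar> \<le> M ^ k"
    using mpow_entry_bound by blast
  define E where "E = (\<chi> i j. \<Sum>k. (((**) Z) ^^ k) (mat 1) $ i $ j / fact k)"
  have "summable (\<lambda>k. (((**) Z) ^^ k) (mat 1) $ i $ j / fact k)" for i j
    by (rule summable_comparison_test[OF _ summable_exp[of M]])
      (auto simp: divide_simps intro: M)
  then have s: "(\<lambda>k. (((**) Z) ^^ k) (mat 1) $ i $ j / fact k) sums (E $ i $ j)" for i j
    unfolding E_def by (simp add: summable_sums)
  then have "(\<lambda>k. (1 / fact k) *\<^sub>R (((**) Z) ^^ k) (mat 1)) sums E"
    unfolding sums_def by (intro vec_tendstoI) (simp add: sum_component)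
  then have "mexp Z = E" unfolding mexp_def by (rule sums_unique[symmetric])
  with s show ?thesis by simp
qed

text \<open>In the parameter \<open>t\<close> each entry of \<open>exp (t Z)\<close> is an everywhere convergent power series whose
  linear coefficient is the entry of \<open>Z\<close>. Thus an equation satisfied by a one-parameter group
  differentiates to a linear equation for its generator. This is how upper bounds for Lie algebras of
  matrix groups are obtained below.\<close>

lemma mexp_nth_has_derivative:
  fixes Z :: "real^'n^'n"
  shows "((\<lambda>t. mexp (t *\<^sub>R Z) $ i $ j) has_real_derivative Z $ i $ j) (at 0)"
proof -
  define c where "c k = (((**) Z) ^^ k) (mat 1) $ i $ j / fact k" for k
  have s: "(\<lambda>k. c k * t ^ k) sums (mexp (t *\<^sub>R Z) $ i $ j)" for t
    using mexp_nth_sums[of "t *\<^sub>R Z" i j] by (simp add: mpow_scaleR c_def mult_ac)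
  have "((\<lambda>t. \<Sum>k. c k * t ^ k) has_field_derivative (\<Sum>k. diffs c k * 0 ^ k)) (at 0)"
    by (rule termdiffs_strong_converges_everywhere) (use s in \<open>blast intro: sums_summable\<close>)
  moreover have "(\<Sum>k. diffs c k * 0 ^ k) = Z $ i $ j"
    unfolding powser_zero by (simp add: diffs_def c_def)
  moreover have "(\<lambda>t. \<Sum>k. c k * t ^ k) = (\<lambda>t. mexp (t *\<^sub>R Z) $ i $ j)"
    using s by (simp add: sums_iff)
  ultimately show ?thesis by simp
qed

text \<open>The diagonal of a power of a triangular matrix consists of the powers of its diagonal. The
  corner entry \<open>y\<close> is left unspecified, because the groups and characters below are cut out by
  conditions on the other three entries.\<close>

lemma mexp_upper_triangular:
  obtains y where "mexp (mat2 a b 0 d) = mat2 (exp a) y 0 (exp d)"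
proof
  let ?P = "\<lambda>k. (((**) (mat2 a b 0 d)) ^^ k) (mat 1)"
  have P: "?P k $ 1 $ 1 = a ^ k \<and> ?P k $ 2 $ 1 = 0 \<and> ?P k $ 2 $ 2 = d ^ k" for k
    by (induction k) (simp_all add: mat_1_eq_mat2 matrix_matrix_mult_def sum_2)
  have exp: "(\<lambda>k. x ^ k / fact k) sums exp x" for x :: real
    using exp_converges[of x] by (simp add: divide_inverse mult_ac)
  note entry = mexp_nth_sums[of "mat2 a b 0 d"]
  show "mexp (mat2 a b 0 d) = mat2 (exp a) (mexp (mat2 a b 0 d) $ 1 $ 2) 0 (exp d)"
    using entry[of 1 1] entry[of 2 1] entry[of 2 2] exp[of a] exp[of d] P
    by (simp add: eq_mat2_iff sums_iff)
qed

lemma mexp_diagonal: "mexp (mat2 a 0 0 d) = mat2 (exp a) 0 0 (exp d)"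
proof -
  have "(((**) (mat2 a 0 0 d)) ^^ k) (mat 1) = mat2 (a ^ k) 0 0 (d ^ k)" for k
    by (induction k) (simp_all add: mat_1_eq_mat2)
  then have "mexp (mat2 a 0 0 d) $ 1 $ 2 = 0"
    using mexp_nth_sums[of "mat2 a 0 0 d" 1 2] by (simp add: sums_iff)
  then show ?thesis
    by (metis mat2_nth(2) mexp_upper_triangular)
qed

lemma mexp_ln_diagonal:
  assumes "0 < a" "a * d = 1"
  shows "mexp (mat2 (ln a) 0 0 (- ln a)) = mat2 a 0 0 d"
  using assms inverse_unique[OF assms(2)] by (simp add: mexp_diagonal exp_minus)

lemma mexp_0: "mexp (0 :: real^2^2) = mat 1"
  by (simp add: zero_eq_mat2 mexp_diagonal mat_1_eq_mat2)

lemma mexp_nilpotent: "mexp (mat2 0 b 0 0) = mat2 1 b 0 1"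
proof -
  have "(((**) (mat2 0 b 0 0)) ^^ k) (mat 1) $ 1 $ 2 / fact k = (if k = 1 then b else 0)" for k
  proof -
    have "(((**) (mat2 0 b 0 0)) ^^ Suc k) (mat 1) = (if k = 0 then mat2 0 b 0 0 else 0)" for k
      by (induction k) (simp_all add: mat_1_eq_mat2 zero_eq_mat2)
    then show ?thesis
      by (cases k) (simp_all add: mat_1_eq_mat2 del: funpow.simps(2))
  qed
  then have "(\<lambda>k. (((**) (mat2 0 b 0 0)) ^^ k) (mat 1) $ 1 $ 2 / fact k) sums b"
    using sums_single[of 1 "\<lambda>_. b"] by presburger
  then have "mexp (mat2 0 b 0 0) $ 1 $ 2 = b"
    using mexp_nth_sums sums_unique2 by blast
  then show ?thesis
    using mexp_upper_triangular[of 0 b 0] by (metis exp_zero mat2_nth(2))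
qed

text \<open>By Cayley-Hamilton a traceless \<open>Z\<close> satisfies \<open>Z\<^sup>2 = d I\<close> with \<open>d = a\<^sup>2 + b c = - det Z\<close>. So
  \<open>exp Z = R I + S Z\<close>, where \<open>R = cosh s\<close>, \<open>s S = sinh s\<close> and \<open>s\<close> is a square root of \<open>d\<close>. The
  determinant is \<open>R\<^sup>2 - d S\<^sup>2 = cosh\<^sup>2 s - sinh\<^sup>2 s = 1\<close>. Since \<open>d\<close> may be negative, \<open>s\<close> is taken
  complex, which treats the hyperbolic, parabolic and elliptic cases at once.\<close>

lemma det_mexp_traceless:
  fixes a b c :: real
  shows "det (mexp (mat2 a b c (- a))) = 1"
proof -
  define Z where "Z = mat2 a b c (- a)"
  define d where "d = a * a + b * c"
  let ?P = "\<lambda>k. (((**) Z) ^^ k) (mat 1)"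
  define p where "p k = (if even k then d ^ (k div 2) else 0)" for k
  define q where "q k = (if even k then 0 else d ^ (k div 2))" for k
  have "?P k = mat2 (p k + q k * a) (q k * b) (q k * c) (p k - q k * a)" for k
  proof (induction k)
    case 0
    then show ?case by (simp add: p_def q_def mat_1_eq_mat2)
  next
    case (Suc k)
    have "p (Suc k) = d * q k" "q (Suc k) = p k"
      by (auto simp: p_def q_def elim!: oddE evenE)
    then show ?case by (simp add: Suc) (simp add: Z_def d_def algebra_simps)
  qed
  \<comment> \<open>Even powers of \<open>Z\<close> are multiples of \<open>I\<close> (coefficient \<open>p\<close>), odd ones of \<open>Z\<close> (coefficient \<open>q\<close>).\<close>
  note P = this
  define s where "s = csqrt (of_real d)"
  have s2: "s ^ 2 = of_real d" by (simp add: s_def)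
  have pc: "of_real (p k / fact k) = (if even k then s ^ k /\<^sub>R fact k else 0)" for k
    by (auto simp: p_def s2[symmetric] power_mult scaleR_conv_of_real divide_inverse elim!: evenE)
  have qc: "s * of_real (q k / fact k) = (if even k then 0 else s ^ k /\<^sub>R fact k)" for k
    by (auto simp: q_def s2[symmetric] power_mult scaleR_conv_of_real divide_inverse elim!: oddE)
  have qb: "\<bar>q k\<bar> \<le> (1 + \<bar>d\<bar>) ^ k" for k
  proof -
    have "\<bar>q k\<bar> \<le> \<bar>d\<bar> ^ (k div 2)" by (simp add: q_def power_abs)
    also have "\<dots> \<le> (1 + \<bar>d\<bar>) ^ (k div 2)" by (rule power_mono) auto
    also have "\<dots> \<le> (1 + \<bar>d\<bar>) ^ k" by (rule power_increasing) auto
    finally show ?thesis .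
  qed
  have "summable (\<lambda>k. q k / fact k)"
    by (rule summable_comparison_test[OF _ summable_exp[of "1 + \<bar>d\<bar>"]])
      (auto simp: divide_simps intro: qb)
  \<comment> \<open>\<open>S\<close> is defined as a real sum and not as \<open>sinh s / s\<close>, whose value is wrong in the parabolic case \<open>s = 0\<close>.\<close>
  then obtain S where S: "(\<lambda>k. q k / fact k) sums S" by blast
  have C': "(\<lambda>k. complex_of_real (p k / fact k)) sums cosh s"
    using cosh_converges[of s] by (simp only: pc)
  have C: "(\<lambda>k. p k / fact k) sums Re (cosh s)" 
    using sums_Re[OF C'] by (simp only: Re_complex_of_real)
  define R where "R = Re (cosh s)"
  have R: "of_real R = cosh s"
    using C' sums_of_real[OF C, where 'a = complex] unfolding R_def by (rule sums_unique2[symmetric])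
  have "(\<lambda>k. s * of_real (q k / fact k)) sums (s * of_real S)"
    by (intro sums_mult sums_of_real S)
  then have S': "s * of_real S = sinh s"
    using sinh_converges[of s] unfolding qc by (rule sums_unique2)
  have "cosh s ^ 2 - sinh s ^ 2 = 1" by (rule hyperbolic_pythagoras)
  then have "complex_of_real (R ^ 2 - d * S ^ 2) = of_real 1"
    unfolding R[symmetric] S'[symmetric] by (simp add: power_mult_distrib s2)
  then have one: "R ^ 2 - d * S ^ 2 = 1" by (simp only: of_real_eq_iff)
  note sm = mexp_nth_sums[of Z, unfolded P]
  have comb: "(\<lambda>k. (u * p k + v * q k) / fact k) sums (u * R + v * S)" for u v
    using sums_add[OF sums_mult[OF C, of u] sums_mult[OF S, of v]]
    by (simp add: R_def add_divide_distrib mult_ac)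
  have "mexp Z = mat2 (R + a * S) (b * S) (c * S) (R - a * S)"
    unfolding eq_mat2_iff
    using sums_unique2[OF sm[of 1 1]] sums_unique2[OF sm[of 1 2]] sums_unique2[OF sm[of 2 1]]
      sums_unique2[OF sm[of 2 2]] comb[of 1 a] comb[of 0 b] comb[of 0 c] comb[of 1 "- a"]
    by (simp add: mult_ac)
  then show ?thesis using one by (simp add: Z_def d_def algebra_simps power2_eq_square)
qed

section \<open>The Lie algebra of traceless matrices and its dual\<close>

lemma mat2_in_SL2 [simp]: "mat2 a b c d \<in> SL2 \<longleftrightarrow> a * d - b * c = 1"
  by (simp add: SL2_def)

text \<open>The derivative of the determinant at the identity is the trace.\<close>

lemma traceless_if_mexp_in_SL2:
  assumes "\<And>t. mexp (t *\<^sub>R Z) \<in> SL2"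
  shows "Z $ 2 $ 2 = - Z $ 1 $ 1"
proof -
  note D = mexp_nth_has_derivative[of Z]
  have "((\<lambda>t. det (mexp (t *\<^sub>R Z))) has_real_derivative Z $ 1 $ 1 + Z $ 2 $ 2) (at 0)"
    unfolding det_2
    by (rule derivative_eq_intros D refl)+ (simp add: mexp_0 mat_def)
  moreover have "(\<lambda>t. det (mexp (t *\<^sub>R Z))) = (\<lambda>t. 1)"
    using assms by (simp add: SL2_def)
  ultimately have "Z $ 1 $ 1 + Z $ 2 $ 2 = 0"
    using DERIV_unique[OF _ DERIV_const] by metis
  then show ?thesis by simp
qed

lemma mat2_in_sl2 [simp]: "mat2 a b c d \<in> sl2 \<longleftrightarrow> d = - a"
proof
  assume "mat2 a b c d \<in> sl2"
  then show "d = - a"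
    using traceless_if_mexp_in_SL2[of "mat2 a b c d"] by (simp add: sl2_def lie_algebra_def)
next
  assume "d = - a"
  then show "mat2 a b c d \<in> sl2"
    by (simp add: sl2_def lie_algebra_def SL2_def det_mexp_traceless)
qed

lemma sl2_cases:
  assumes "Z \<in> sl2"
  obtains a b c where "Z = mat2 a b c (- a)"
  using assms by (cases Z) auto

lemma mH_mX_mY:
  "mH = mat2 1 0 0 (- 1)" "mX = mat2 0 1 1 0" "mY = mat2 0 1 (- 1) 0"
  by (simp_all add: mH_def mX_def mY_def mat2_def)

text \<open>Coordinates of \<open>a H + (b + c)/2 X + (b - c)/2 Y\<close>. From here on the basis \<open>H, X, Y\<close> is traded for
  matrix entries, in which conjugation and triangularity are easier to express.\<close>

lemma dual_basis_mat2:
  "dual_basis mH (mat2 a b c (- a)) = a"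
  "dual_basis mX (mat2 a b c (- a)) = (b + c) / 2"
  "dual_basis mY (mat2 a b c (- a)) = (b - c) / 2"
proof -
  let ?B = "{mH, mX, mY}"
  have indep: "independent ?B"
    by (simp add: independent_insert span_insert mH_mX_mY eq_mat2_iff zero_eq_mat2)
  have eq: "mat2 a b c (- a) = a *\<^sub>R mH + ((b + c) / 2) *\<^sub>R mX + ((b - c) / 2) *\<^sub>R mY"
    by (simp add: mH_mX_mY field_simps)
  have in_span: "mH \<in> span ?B" "mX \<in> span ?B" "mY \<in> span ?B"
    by (auto intro: span_base)
  have distinct: "mH \<noteq> mX" "mH \<noteq> mY" "mX \<noteq> mY"
    by (auto simp: mH_mX_mY)
  have "representation ?B (mat2 a b c (- a)) =
    (\<lambda>v. a * (if v = mH then 1 else 0) + (b + c) / 2 * (if v = mX then 1 else 0)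
       + (b - c) / 2 * (if v = mY then 1 else 0))"
    unfolding eq using indep in_span
    by (simp add: real_vector.representation_add real_vector.representation_scale
        real_vector.representation_basis span_add span_scale fun_eq_iff)
  then show "dual_basis mH (mat2 a b c (- a)) = a"
    "dual_basis mX (mat2 a b c (- a)) = (b + c) / 2"
    "dual_basis mY (mat2 a b c (- a)) = (b - c) / 2"
    using distinct by (simp_all add: dual_basis_def)
qed

text \<open>In these coordinates a functional is determined by its values \<open>p\<close>, \<open>q\<close>, \<open>r\<close> on \<open>H\<close> and on the two
  elementary nilpotent matrices. It is restricted to \<open>sl2\<close> so that it can be an element of \<open>dual sl2\<close>.\<close>

definition sl2_functional :: "real \<Rightarrow> real \<Rightarrow> real \<Rightarrow> real^2^2 \<Rightarrow> real"
  where "sl2_functional p q r = (\<lambda>Z\<in>sl2. p * Z $ 1 $ 1 + q * Z $ 1 $ 2 + r * Z $ 2 $ 1)"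

lemma sl2_functional_mat2 [simp]: "sl2_functional p q r (mat2 a b c (- a)) = p * a + q * b + r * c"
  by (simp add: sl2_functional_def)

lemma sl2_functional_inject [simp]:
  "sl2_functional p q r = sl2_functional p' q' r' \<longleftrightarrow> p = p' \<and> q = q' \<and> r = r'"
proof
  assume eq: "sl2_functional p q r = sl2_functional p' q' r'"
  show "p = p' \<and> q = q' \<and> r = r'"
    using fun_cong[OF eq, of "mat2 1 0 0 (- 1)"] fun_cong[OF eq, of "mat2 0 1 0 (- 0)"]
      fun_cong[OF eq, of "mat2 0 0 1 (- 0)"] unfolding sl2_functional_mat2 by simp
qed auto

lemma sl2_functional_eqI:
  assumes "\<And>a b c. f (mat2 a b c (- a)) = p * a + q * b + r * c"
  shows "restrict f sl2 = sl2_functional p q r"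
  by (rule ext) (auto simp: assms restrict_def sl2_functional_def elim!: sl2_cases)

lemma F_hat_eq: "F_hat lam = sl2_functional (2 * lam) 0 0"
  unfolding F_hat_def by (rule sl2_functional_eqI) (simp add: dual_basis_mat2)

text \<open>The substitution \<open>p = 2 h\<close>, \<open>q = x - y\<close>, \<open>r = x + y\<close> factors \<open>x\<^sup>2 - y\<^sup>2\<close>. Both the orbit
  computation and the Pukanszky condition become short in this form: the line \<open>p = 2 lam\<close>, \<open>q = 0\<close>
  through \<open>F_hat lam\<close> visibly lies on the quadric.\<close>

lemma Omega1_eq: "Omega1 lam = {sl2_functional p q r | p q r. p\<^sup>2 + 4 * q * r = 4 * lam\<^sup>2}"
proof -
  have coords: "(\<lambda>Z\<in>sl2. 2 * x * dual_basis mX Z + 2 * h * dual_basis mH Z - 2 * y * dual_basis mY Z) =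
    sl2_functional (2 * h) (x - y) (x + y)" for x h y
    by (rule sl2_functional_eqI) (simp add: dual_basis_mat2 field_simps)
  show ?thesis unfolding Omega1_def coords
  proof (intro equalityI subsetI)
    fix f assume "f \<in> {sl2_functional (2 * h) (x - y) (x + y) | x h y. x\<^sup>2 + h\<^sup>2 = y\<^sup>2 + lam\<^sup>2}"
    then obtain x h y where f: "f = sl2_functional (2 * h) (x - y) (x + y)"
      and "x\<^sup>2 + h\<^sup>2 = y\<^sup>2 + lam\<^sup>2" by blast
    then have "(2 * h)\<^sup>2 + 4 * (x - y) * (x + y) = 4 * lam\<^sup>2"
      by (simp add: power2_eq_square algebra_simps)
    with f show "f \<in> {sl2_functional p q r | p q r. p\<^sup>2 + 4 * q * r = 4 * lam\<^sup>2}" by blast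
  next
    fix f assume "f \<in> {sl2_functional p q r | p q r. p\<^sup>2 + 4 * q * r = 4 * lam\<^sup>2}"
    then obtain p q r where f: "f = sl2_functional p q r" and *: "p\<^sup>2 + 4 * q * r = 4 * lam\<^sup>2" by blast
    define x h y where "x = (q + r) / 2" and "h = p / 2" and "y = (r - q) / 2"
    have pqr: "p = 2 * h" "q = x - y" "r = x + y"
      by (simp_all add: x_def h_def y_def field_simps)
    have "x\<^sup>2 + h\<^sup>2 = y\<^sup>2 + lam\<^sup>2"
      using * by (simp add: pqr power2_eq_square algebra_simps)
    with f show "f \<in> {sl2_functional (2 * h) (x - y) (x + y) | x h y. x\<^sup>2 + h\<^sup>2 = y\<^sup>2 + lam\<^sup>2}"
      unfolding pqr by blast
  qed
qed

lemma dual_sl2_cases: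
  assumes "P \<in> dual sl2"
  obtains p q r where "P = sl2_functional p q r"
proof
  have add: "P (Z + W) = P Z + P W" and scale: "P (t *\<^sub>R Z) = t * P Z"
    if "Z \<in> sl2" "W \<in> sl2" for Z W t
    using assms that by (auto simp: dual_def)
  define E where "E = mat2 0 1 0 (0::real)"
  define E' where "E' = mat2 0 0 1 (0::real)"
  have in_sl2: "mH \<in> sl2" "E \<in> sl2" "E' \<in> sl2"
    by (simp_all add: mH_mX_mY E_def E'_def)
  have eq: "P (mat2 a b c (- a)) = P mH * a + P E * b + P E' * c" for a b c
  proof -
    have "P (mat2 a b c (- a)) = P ((a *\<^sub>R mH + b *\<^sub>R E) + c *\<^sub>R E')"
      by (simp add: mH_mX_mY E_def E'_def)
    also have "\<dots> = P (a *\<^sub>R mH + b *\<^sub>R E) + P (c *\<^sub>R E')"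
      by (rule add) (simp_all add: mH_mX_mY E_def E'_def)
    also have "P (a *\<^sub>R mH + b *\<^sub>R E) = P (a *\<^sub>R mH) + P (b *\<^sub>R E)"
      by (rule add) (simp_all add: mH_mX_mY E_def)
    finally show ?thesis
      using scale[of mH mH a] scale[of E E b] scale[of E' E' c]
      using in_sl2 by (simp add: mult.commute)
  qed
  have "P = restrict P sl2" using assms by (simp add: dual_def extensional_restrict)
  also have "\<dots> = sl2_functional (P mH) (P E) (P E')" by (rule sl2_functional_eqI) (rule eq)
  finally show "P = sl2_functional (P mH) (P E) (P E')" .
qed

lemma sl2_functional_in_dual: "sl2_functional p q r \<in> dual sl2"
proof -
  have "Z + W \<in> sl2 \<and> t *\<^sub>R Z \<in> sl2" if "Z \<in> sl2" "W \<in> sl2" for Z W and t :: real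
    using that by (auto elim!: sl2_cases)
  then show ?thesis
    by (auto simp: dual_def sl2_functional_def algebra_simps)
qed

section \<open>The coadjoint orbit and the stabilizer\<close>

text \<open>\<open>F_hat lam\<close> reads off \<open>2 lam\<close> times the upper left entry, so only that entry of \<open>g\<^sup>-\<^sup>1 Z g\<close> matters.\<close>

lemma coadjoint_F_hat:
  assumes "a * d - b * c = 1"
  shows "coadjoint SL2 (mat2 a b c d) (F_hat lam) =
    sl2_functional (2 * lam * (a * d + b * c)) (2 * lam * c * d) (- 2 * lam * a * b)"
proof -
  have "matrix_inv (mat2 a b c d) = mat2 d (- b) (- c) a"
    by (rule matrix_inv_mat2[OF assms])
  moreover have "matrix_inv (mat2 d (- b) (- c) a) = mat2 a b c d"
    using assms by (subst matrix_inv_mat2) (simp_all add: mult.commute)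
  ultimately have Ad: "Ad (matrix_inv (mat2 a b c d)) (mat2 x y z (- x)) =
    mat2 ((a * d + b * c) * x + c * d * y - a * b * z) (2 * b * d * x + d * d * y - b * b * z)
     (- 2 * a * c * x - c * c * y + a * a * z) (- ((a * d + b * c) * x + c * d * y - a * b * z))" for x y z
    by (simp add: Ad_def algebra_simps)
  show ?thesis unfolding coadjoint_def sl2_def[symmetric]
    by (rule sl2_functional_eqI) (simp only: Ad F_hat_eq sl2_functional_mat2, simp add: algebra_simps)
qed

text \<open>That the orbit lies on the quadric is the identity
  \<open>(a d + b c)\<^sup>2 = (a d - b c)\<^sup>2 + 4 a b c d\<close>. Conversely, after division by \<open>2 lam\<close> a point of the
  quadric has coordinates \<open>(k, u, - v)\<close> with \<open>k\<^sup>2 = 1 + 4 u v\<close>, and a matrix is needed with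
  \<open>a d - b c = 1\<close>, \<open>a d + b c = k\<close>, \<open>c d = u\<close>, \<open>a b = v\<close>. These equations force \<open>a d = (k + 1) / 2\<close> and
  \<open>b c = (k - 1) / 2\<close>. If \<open>k \<noteq> - 1\<close>, then \<open>a d \<noteq> 0\<close> and scaling by the stabilizer allows \<open>a = 1\<close>, which
  determines the rest. If \<open>k = - 1\<close>, then \<open>a d = 0\<close> and \<open>u v = 0\<close>, and the matrix can be chosen with one
  vanishing diagonal entry and off-diagonal entries \<open>1\<close> and \<open>- 1\<close>.\<close>

lemma coadjoint_orbit_F_hat:
  assumes "lam \<noteq> 0"
  shows "coadjoint_orbit SL2 (F_hat lam) = Omega1 lam"
proof (intro equalityI subsetI)
  fix f assume "f \<in> coadjoint_orbit SL2 (F_hat lam)"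
  then obtain g where "g \<in> SL2" and f: "f = coadjoint SL2 g (F_hat lam)"
    by (auto simp: coadjoint_orbit_def)
  then obtain a b c d where g: "g = mat2 a b c d" and det: "a * d - b * c = 1"
    by (cases g) auto
  have "(a * d + b * c)\<^sup>2 = (a * d - b * c)\<^sup>2 + 4 * (c * d) * (a * b)"
    by (simp add: power2_eq_square algebra_simps)
  then have "(2 * lam * (a * d + b * c))\<^sup>2 + 4 * (2 * lam * c * d) * (- 2 * lam * a * b) = 4 * lam\<^sup>2"
    by (simp add: det power_mult_distrib) (simp add: power2_eq_square algebra_simps)
  then show "f \<in> Omega1 lam"
    unfolding f g coadjoint_F_hat[OF det] Omega1_eq by blast
next
  fix f assume "f \<in> Omega1 lam"
  then obtain p q r where f: "f = sl2_functional p q r" and eq: "p\<^sup>2 + 4 * q * r = 4 * lam\<^sup>2"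
    by (auto simp: Omega1_eq)
  define k u v where "k = p / (2 * lam)" and "u = q / (2 * lam)" and "v = - r / (2 * lam)"
  have pqr: "p = 2 * lam * k" "q = 2 * lam * u" "r = - 2 * lam * v"
    using assms by (simp_all add: k_def u_def v_def)
  have "4 * lam\<^sup>2 * (k\<^sup>2 - 4 * u * v) = 4 * lam\<^sup>2 * 1"
    using eq by (simp add: pqr power2_eq_square algebra_simps)
  then have kuv: "k\<^sup>2 = 1 + 4 * u * v"
    using assms by simp
  have "\<exists>a b c d. a * d - b * c = 1 \<and> a * d + b * c = k \<and> c * d = u \<and> a * b = v"
  proof (cases "k = - 1")
    case False
    have "u * v = (k - 1) * (k + 1) / 4" using kuv by (simp add: power2_eq_square algebra_simps)
    then have bc: "v * (u * 2 / (k + 1)) = (k - 1) / 2"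
      using False by (simp add: field_simps)
    show ?thesis
      by (intro exI[of _ 1] exI[of _ v] exI[of _ "u * 2 / (k + 1)"] exI[of _ "(k + 1) / 2"])
        (use bc False in \<open>simp add: field_simps\<close>)
  next
    case True
    then have "u = 0 \<or> v = 0" using kuv by simp
    then show ?thesis
    proof
      assume "u = 0"
      then show ?thesis using True
        by (intro exI[of _ v] exI[of _ 1] exI[of _ "- 1"] exI[of _ 0]) simp
    next
      assume "v = 0"
      then show ?thesis using True
        by (intro exI[of _ 0] exI[of _ 1] exI[of _ "- 1"] exI[of _ "- u"]) simp
    qed
  qed
  then obtain a b c d where det: "a * d - b * c = 1"
    and "a * d + b * c = k" "c * d = u" "a * b = v" by blast
  then have "f = coadjoint SL2 (mat2 a b c d) (F_hat lam)"
    unfolding f pqr by (subst coadjoint_F_hat[OF det]) (simp add: mult.assoc)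
  with det show "f \<in> coadjoint_orbit SL2 (F_hat lam)"
    by (auto simp: coadjoint_orbit_def intro!: rev_image_eqI[of "mat2 a b c d"])
qed

text \<open>Fixing \<open>F_hat lam\<close> means \<open>a d + b c = 1 = a d - b c\<close>, hence \<open>a d = 1\<close> and \<open>b c = 0\<close>; as then
  neither \<open>a\<close> nor \<open>d\<close> vanishes, \<open>c d = 0 = a b\<close> kills both off-diagonal entries.\<close>

lemma mat2_in_stabilizer:
  assumes "lam \<noteq> 0"
  shows "mat2 a b c d \<in> stabilizer SL2 (F_hat lam) \<longleftrightarrow> b = 0 \<and> c = 0 \<and> a * d = 1"
proof -
  have "mat2 a b c d \<in> stabilizer SL2 (F_hat lam) \<longleftrightarrow>
    a * d - b * c = 1 \<and> a * d + b * c = 1 \<and> c * d = 0 \<and> a * b = 0"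
  proof (cases "a * d - b * c = 1")
    case True
    then have "coadjoint SL2 (mat2 a b c d) (F_hat lam) = F_hat lam \<longleftrightarrow>
      a * d + b * c = 1 \<and> c * d = 0 \<and> a * b = 0"
      using assms by (simp add: coadjoint_F_hat) (simp add: F_hat_eq)
    with True show ?thesis by (simp add: stabilizer_def)
  qed (simp add: stabilizer_def)
  also have "\<dots> \<longleftrightarrow> b = 0 \<and> c = 0 \<and> a * d = 1" by auto
  finally show ?thesis .
qed

lemma stabilizer_cases:
  assumes "lam \<noteq> 0" "g \<in> stabilizer SL2 (F_hat lam)"
  obtains a d where "g = mat2 a 0 0 d" "a * d = 1"
proof -
  obtain a b c d where g: "g = mat2 a b c d" by (rule mat2_cases)
  then have "b = 0" "c = 0" "a * d = 1" using assms by (simp_all add: mat2_in_stabilizer)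
  with g that show ?thesis by blast
qed

lemma lie_algebra_stabilizer_cases:
  assumes "lam \<noteq> 0" and "Z \<in> lie_algebra (stabilizer SL2 (F_hat lam))"
  obtains a where "Z = mat2 a 0 0 (- a)"
proof -
  have diag: "mexp (t *\<^sub>R Z) \<in> SL2" "mexp (t *\<^sub>R Z) $ 1 $ 2 = 0" "mexp (t *\<^sub>R Z) $ 2 $ 1 = 0" for t
  proof -
    have mem: "mexp (t *\<^sub>R Z) \<in> stabilizer SL2 (F_hat lam)"
      using assms(2) by (simp add: lie_algebra_def)
    then show "mexp (t *\<^sub>R Z) \<in> SL2" by (simp add: stabilizer_def)
    show "mexp (t *\<^sub>R Z) $ 1 $ 2 = 0" "mexp (t *\<^sub>R Z) $ 2 $ 1 = 0"
      using mem by (cases "mexp (t *\<^sub>R Z)"; simp add: mat2_in_stabilizer[OF assms(1)])+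
  qed
  have "Z $ 1 $ 2 = 0" "Z $ 2 $ 1 = 0"
    using mexp_nth_has_derivative[of Z 1 2] mexp_nth_has_derivative[of Z 2 1] diag
    by (auto intro: DERIV_unique[OF _ DERIV_const])
  moreover have "Z $ 2 $ 2 = - Z $ 1 $ 1"
    by (rule traceless_if_mexp_in_SL2[OF diag(1)])
  ultimately show ?thesis
    using that[of "Z $ 1 $ 1"] by (simp add: eq_mat2_iff)
qed

section \<open>The polarizing subalgebra and its groups\<close>

text \<open>\<open>X + Y\<close> is twice the upper elementary nilpotent matrix, so \<open>eta\<close> is the Borel subalgebra of
  traceless upper triangular matrices.\<close>

lemma mat2_in_eta [simp]: "mat2 a b c d \<in> eta \<longleftrightarrow> c = 0 \<and> d = - a"
proof -
  have "mat2 a b c d \<in> eta \<longleftrightarrow> (\<exists>k l. mat2 a b c d - cscale k (cplx mH) - cscale l (cplx (mX + mY)) = 0)"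
    by (simp add: eta_def cmat.span_insert)
  also have "\<dots> \<longleftrightarrow> (\<exists>k l. a = k \<and> b = 2 * l \<and> c = 0 \<and> d = - k)"
    by (simp add: mH_mX_mY zero_eq_mat2 mult.commute add_eq_0_iff2 conj_commute)
  also have "\<dots> \<longleftrightarrow> c = 0 \<and> d = - a"
    by (auto intro: exI[of _ "b / 2"])
  finally show ?thesis .
qed

lemma eta_cases:
  assumes "Z \<in> eta"
  obtains a b where "Z = mat2 a b 0 (- a)"
  using assms by (cases Z) auto

lemma mat2_in_frak_h [simp]: "mat2 a b c d \<in> frak_h \<longleftrightarrow> c = 0 \<and> d = - a"
  by (auto simp: frak_h_def real_points_def simp flip: of_real_minus)

lemma frak_h_cases:
  assumes "Z \<in> frak_h"
  obtains a b where "Z = mat2 a b 0 (- a)"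
  using assms by (cases Z) auto

text \<open>Exponentials of upper triangular matrices have positive diagonal, and so have their products.
  Conversely, each such matrix of determinant \<open>1\<close> is a unipotent one times a positive diagonal one, and
  both factors are exponentials.\<close>

lemma mat2_in_H_0 [simp]: "mat2 a b c d \<in> H_0 \<longleftrightarrow> c = 0 \<and> 0 < a \<and> a * d = 1"
proof
  have "g $ 2 $ 1 = 0 \<and> 0 < g $ 1 $ 1 \<and> g $ 1 $ 1 * g $ 2 $ 2 = 1" if "g \<in> H_0" for g
    using that unfolding H_0_def
  proof induction
    case one
    then show ?case by (simp add: mat_1_eq_mat2)
  next
    case (mult Z g)
    from mult.hyps(1) obtain a b where "Z = mat2 a b 0 (- a)" by (rule frak_h_cases)
    then obtain y where "mexp Z = mat2 (exp a) y 0 (exp (- a))" using mexp_upper_triangular by metis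
    then show ?case using mult.IH by (cases g) (auto simp: exp_minus field_simps)
  qed
  from this[of "mat2 a b c d"] show "mat2 a b c d \<in> H_0 \<Longrightarrow> c = 0 \<and> 0 < a \<and> a * d = 1" by simp
next
  assume *: "c = 0 \<and> 0 < a \<and> a * d = 1"
  then have "mat2 a b c d = mexp (mat2 0 (b * a) 0 0) ** (mexp (mat2 (ln a) 0 0 (- ln a)) ** mat 1)"
    using mexp_ln_diagonal[of a d] by (simp add: mexp_nilpotent mult.assoc)
  also have "\<dots> \<in> H_0"
    unfolding H_0_def by (intro connected_subgroup.intros) simp_all
  finally show "mat2 a b c d \<in> H_0" .
qed

text \<open>The stabilizer contributes exactly the sign of the diagonal that \<open>H_0\<close> lacks.\<close>

lemma mat2_in_H_bold:
  assumes "lam \<noteq> 0"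
  shows "mat2 a b c d \<in> H_bold lam \<longleftrightarrow> c = 0 \<and> a * d = 1"
proof
  assume "mat2 a b c d \<in> H_bold lam"
  then obtain g h where eq: "mat2 a b c d = g ** h"
    and "g \<in> stabilizer SL2 (F_hat lam)" "h \<in> H_0"
    by (auto simp: H_bold_def set_mult_def)
  then show "c = 0 \<and> a * d = 1"
    by (cases g; cases h) (auto simp: mat2_in_stabilizer[OF assms] algebra_simps)
next
  assume *: "c = 0 \<and> a * d = 1"
  then have a: "a \<noteq> 0" and d: "d = inverse a"
    by (auto dest: inverse_unique)
  have "mat2 a b c d = mat2 (sgn a) 0 0 (sgn a) ** mat2 \<bar>a\<bar> (sgn a * b) 0 \<bar>d\<bar>"
    using * a
    by (cases a "0 :: real" rule: linorder_cases) (auto simp: d)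
  moreover have "mat2 (sgn a) 0 0 (sgn a) \<in> stabilizer SL2 (F_hat lam)"
    "mat2 \<bar>a\<bar> (sgn a * b) 0 \<bar>d\<bar> \<in> H_0"
    using * a by (auto simp: mat2_in_stabilizer[OF assms] sgn_if simp flip: abs_mult)
  ultimately show "mat2 a b c d \<in> H_bold lam"
    unfolding H_bold_def set_mult_def by blast
qed

lemma in_H_bold_iff:
  assumes "lam \<noteq> 0"
  shows "g \<in> H_bold lam \<longleftrightarrow> g $ 2 $ 1 = 0 \<and> g $ 1 $ 1 * g $ 2 $ 2 = 1"
  by (cases g) (simp add: mat2_in_H_bold[OF assms])

lemma H_bold_eq:
  assumes "lam \<noteq> 0"
  shows "H_bold lam = H_0 \<union> (\<lambda>g. epsilon ** g) ` H_0"
proof -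
  have eps: "epsilon ** mat2 a b c d = mat2 (- a) (- b) (- c) (- d)" for a b c d
    by (simp add: epsilon_def eq_mat2_iff matrix_matrix_mult_def sum_2 mat_def)
  have "mat2 a b c d \<in> (\<lambda>g. epsilon ** g) ` H_0 \<longleftrightarrow> mat2 (- a) (- b) (- c) (- d) \<in> H_0" for a b c d
  proof
    assume "mat2 a b c d \<in> (\<lambda>g. epsilon ** g) ` H_0"
    then obtain g where g: "mat2 a b c d = epsilon ** g" "g \<in> H_0" by blast
    then show "mat2 (- a) (- b) (- c) (- d) \<in> H_0"
      by (cases g) (simp add: eps)
  qed (auto simp: eps intro!: rev_image_eqI[of "mat2 (- a) (- b) (- c) (- d)"])
  then have "mat2 a b c d \<in> H_bold lam \<longleftrightarrow> mat2 a b c d \<in> H_0 \<union> (\<lambda>g. epsilon ** g) ` H_0" for a b c d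
    by (cases a "0 :: real" rule: linorder_cases) (auto simp: mat2_in_H_bold[OF assms])
  then show ?thesis by (metis mat2_cases subsetI subset_antisym)
qed

lemma H_0_subset_H_bold: "lam \<noteq> 0 \<Longrightarrow> H_0 \<subseteq> H_bold lam"
  by (simp add: H_bold_eq)

lemma closed_lower_left_zero: "closed {g :: real^2^2. g $ 2 $ 1 = 0}"
  by (intro closed_Collect_eq continuous_intros)

text \<open>The strict inequality \<open>0 < g\<^sub>1\<^sub>1\<close> defining \<open>H_0\<close> can be relaxed to \<open>0 \<le> g\<^sub>1\<^sub>1\<close>, because a
  triangular matrix of determinant \<open>1\<close> has nonzero diagonal.\<close>

lemma closedin_H_0: "closedin (top_of_set SL2) H_0"
proof -
  have "H_0 = SL2 \<inter> ({g. g $ 2 $ 1 = 0} \<inter> {g. 0 \<le> g $ 1 $ 1})"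
  proof (intro set_eqI)
    fix g :: "real^2^2"
    show "g \<in> H_0 \<longleftrightarrow> g \<in> SL2 \<inter> ({g. g $ 2 $ 1 = 0} \<inter> {g. 0 \<le> g $ 1 $ 1})"
      by (cases g) (auto simp: less_le)
  qed
  moreover have "closed ({g :: real^2^2. g $ 2 $ 1 = 0} \<inter> {g. 0 \<le> g $ 1 $ 1})"
    by (intro closed_Int closed_lower_left_zero closed_Collect_le continuous_intros)
  ultimately show ?thesis by (metis closedin_closed_Int)
qed

lemma closedin_H_bold:
  assumes "lam \<noteq> 0"
  shows "closedin (top_of_set SL2) (H_bold lam)"
proof -
  have "H_bold lam = SL2 \<inter> {g. g $ 2 $ 1 = 0}"
    by (auto simp: in_H_bold_iff[OF assms] SL2_def det_2)
  then show ?thesis by (metis closedin_closed_Int closed_lower_left_zero)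
qed

lemma linear_lie_group_SL2: "linear_lie_group SL2"
proof -
  have "closed SL2"
    unfolding SL2_def det_2 by (intro closed_Collect_eq continuous_intros)
  moreover have inv: "invertible g \<and> matrix_inv g \<in> SL2" if "g \<in> SL2" for g
    using that by (cases g) (simp add: matrix_inv_mat2 mult.commute)
  ultimately have "closedin (top_of_set {g. invertible g}) SL2"
    by (intro closed_subset) auto
  then show ?thesis
    using inv by (auto simp: linear_lie_group_def SL2_def det_mul)
qed

lemma complex_subalgebra_eta: "complex_subalgebra eta"
  unfolding complex_subalgebra_def
proof
  show "cmat.subspace eta" unfolding eta_def by (rule cmat.subspace_span)
  show "\<forall>Z\<in>eta. \<forall>W\<in>eta. bracket Z W \<in> eta"
    by (auto simp: bracket_def elim!: eta_cases)
qed

text \<open>Complex conjugation preserves \<open>eta\<close>, that is, the polarization is real. Therefore \<open>\<mm> = \<hh>\<close> and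
  \<open>M0 = H_0\<close>, and the conditions on \<open>\<mm>\<close> reduce to those on \<open>\<hh>\<close>.\<close>

lemma sum_conj_eta: "sum_conj eta = eta"
proof
  show "sum_conj eta \<subseteq> eta"
    by (auto simp: sum_conj_def elim!: eta_cases)
  have "0 \<in> eta" by (simp add: zero_eq_mat2)
  moreover have "map_matrix cnj 0 = (0 :: complex^2^2)" by (simp add: zero_eq_mat2)
  ultimately show "eta \<subseteq> sum_conj eta"
    unfolding sum_conj_def by (smt (verit) CollectI add_0_right subsetI)
qed

lemma complexification_frak_h: "complexification frak_h = eta"
proof
  show "complexification frak_h \<subseteq> eta"
    by (auto simp: complexification_def elim!: frak_h_cases)
  show "eta \<subseteq> complexification frak_h"
  proof
    fix Z assume "Z \<in> eta"
    then obtain a b where Z: "Z = mat2 a b 0 (- a)" by (rule eta_cases)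
    have "Z = cplx (mat2 (Re a) (Re b) 0 (- Re a)) + cscale \<i> (cplx (mat2 (Im a) (Im b) 0 (- Im a)))"
      by (simp add: Z complex_eq_iff)
    moreover have "mat2 (Re a) (Re b) 0 (- Re a) \<in> frak_h" "mat2 (Im a) (Im b) 0 (- Im a) \<in> frak_h"
      by simp_all
    ultimately show "Z \<in> complexification frak_h"
      unfolding complexification_def by blast
  qed
qed

lemma eta_subset: "eta \<subseteq> complexification sl2"
proof -
  have "frak_h \<subseteq> sl2" by (auto simp: frak_h_def real_points_def)
  then have "complexification frak_h \<subseteq> complexification sl2"
    unfolding complexification_def by blast
  then show ?thesis by (simp add: complexification_frak_h)
qed

lemma real_subalgebra_frak_h: "real_subalgebra frak_h"
  by (auto simp: real_subalgebra_def subspace_def bracket_def zero_eq_mat2 elim!: frak_h_cases)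

lemma Ad_stabilizer_eta:
  assumes "lam \<noteq> 0" "x \<in> stabilizer SL2 (F_hat lam)"
  shows "Ad (cplx x) ` eta \<subseteq> eta"
proof -
  from assms obtain a d where x: "x = mat2 a 0 0 d" and "a * d = 1"
    by (rule stabilizer_cases)
  then have "matrix_inv (cplx x) = mat2 (of_real d) 0 0 (of_real a)"
    by (simp add: matrix_inv_mat2 flip: of_real_mult)
  then show ?thesis
    by (auto simp: Ad_def x elim!: eta_cases)
qed

lemma cext_F_hat_eta: "cext (F_hat lam) (mat2 a b 0 (- a)) = 2 * lam * a"
  by (simp add: cext_def F_hat_eq complex_eq_iff)

text \<open>A functional vanishing on the upper triangular matrices has the form \<open>Z \<mapsto> r Z\<^sub>2\<^sub>1\<close>. Adding it to
  \<open>F_hat lam\<close> moves along one of the lines that rule the quadric of \<open>Omega1 lam\<close>.\<close>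

lemma pukanszky:
  assumes "P \<in> annihilator sl2 eta"
  shows "(\<lambda>Z\<in>sl2. F_hat lam Z + P Z) \<in> Omega1 lam"
proof -
  have P: "P \<in> dual sl2" "\<And>W. W \<in> eta \<Longrightarrow> cext P W = 0"
    using assms by (auto simp: annihilator_def)
  then obtain p q r where pqr: "P = sl2_functional p q r" by (blast elim: dual_sl2_cases)
  have "p = 0" "q = 0"
    using P(2)[of "mat2 1 0 0 (- 1)"] P(2)[of "mat2 0 1 0 (- 0)"]
    by (simp_all add: pqr cext_def sl2_functional_def)
  then have "(\<lambda>Z\<in>sl2. F_hat lam Z + P Z) = sl2_functional (2 * lam) 0 r"
    by (intro sl2_functional_eqI) (simp add: F_hat_eq pqr)
  then show ?thesis by (auto simp: Omega1_eq power2_eq_square)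
qed

section \<open>One-dimensional representations\<close>

lemma hilbert_rep_subset: "hilbert_rep K U \<Longrightarrow> L \<subseteq> K \<Longrightarrow> hilbert_rep L U"
  unfolding hilbert_rep_def by (meson continuous_on_subset subsetD)

lemma irreducible_rep_complex:
  fixes U :: "real^'n^'n \<Rightarrow> complex"
  assumes "hilbert_rep K (\<lambda>g z. U g * z)"
  shows "irreducible_rep K (\<lambda>g z. U g * z)"
proof -
  have "W = UNIV" if W: "complex_hilbert.subspace W" "w \<in> W" "w \<noteq> 0" for W and w :: complex
  proof -
    have "z = (z / w) *\<^sub>C w" for z using W by (simp add: scaleC_complex_def)
    then show ?thesis
      by (metis UNIV_eq_I W(1,2) complex_hilbert.subspace_scale)
  qed
  then have "W = {0} \<or> W = UNIV" if "complex_hilbert.subspace W" for W :: "complex set"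
    using that complex_hilbert.subspace_0 by blast
  then show ?thesis
    using assms unfolding irreducible_rep_def by (metis one_neq_zero)
qed

lemma essentially_selfadjoint_real_scaling:
  "essentially_selfadjoint (UNIV :: complex set) (\<lambda>v. of_real r * v)"
proof -
  let ?T = "{(v, of_real r * v) | v :: complex. v \<in> UNIV}"
  have "?T = {p. snd p = of_real r * fst p}" by auto
  moreover have "closed {p :: complex \<times> complex. snd p = of_real r * fst p}"
    by (intro closed_Collect_eq continuous_intros)
  ultimately have "closure ?T = ?T" by simp
  moreover have "adjoint_graph ?T = ?T"
  proof -
    have "(\<forall>x. cinner (of_real r * x) y = cinner x z) \<longleftrightarrow> z = of_real r * y" for y z :: complex
    proof
      assume "\<forall>x. cinner (of_real r * x) y = cinner x z"
      from this[rule_format, of 1] have "cnj (of_real r * y) = cnj z"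
        by (simp add: cinner_complex_def)
      then show "z = of_real r * y" by (simp only: complex_cnj_cancel_iff)
    qed (simp add: cinner_complex_def)
    then show ?thesis by (auto simp: adjoint_graph_def)
  qed
  ultimately show ?thesis
    by (simp add: essentially_selfadjoint_def scaleC_complex_def algebra_simps)
qed

text \<open>An operator of multiplication by an imaginary number has a real square. A sum of such
  squares is therefore again a real scalar, which is a bounded self-adjoint operator.\<close>

lemma nelson_condition_imaginary:
  fixes \<pi> :: "real^'n^'n \<Rightarrow> complex"
  assumes "\<And>Z. Z \<in> \<aa> \<Longrightarrow> \<pi> Z = \<i> * of_real (f Z)"
  shows "nelson_condition \<aa> UNIV (\<lambda>Z z. \<pi> Z * z)"
proof -
  have "essentially_selfadjoint UNIV (\<lambda>v. \<Sum>b\<in>B. \<pi> b * (\<pi> b * v))" if "span B = \<aa>" for B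
  proof -
    have "(\<Sum>b\<in>B. \<pi> b * (\<pi> b * v)) = of_real (\<Sum>b\<in>B. - (f b)\<^sup>2) * v" for v
    proof -
      have "\<pi> b * (\<pi> b * v) = of_real (- (f b)\<^sup>2) * v" if "b \<in> B" for b
        using assms[of b] that span_base[of b B] \<open>span B = \<aa>\<close>
        by (simp add: power2_eq_square) (simp add: algebra_simps)
      then show ?thesis by (simp add: sum_distrib_right)
    qed
    then have "(\<lambda>v. \<Sum>b\<in>B. \<pi> b * (\<pi> b * v)) = (\<lambda>v. of_real (\<Sum>b\<in>B. - (f b)\<^sup>2) * v)"
      by (rule ext)
    then show ?thesis by (simp only: essentially_selfadjoint_real_scaling)
  qed
  then show ?thesis by (simp add: nelson_condition_def)
qed

text \<open>The diagonal entry is multiplicative on triangular matrices, so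
  \<open>g \<mapsto> |g\<^sub>1\<^sub>1|\<^bsup>4\<pi>i lam\<^esup>\<close> is a character of \<open>\<^bold>H\<close>; it is multiplied by the sign of \<open>g\<^sub>1\<^sub>1\<close> when \<open>s = - 1\<close>.
  The sign is continuous because \<open>g\<^sub>1\<^sub>1\<close> does not vanish on \<open>\<^bold>H\<close>.\<close>

lemma extends_U_exists:
  assumes "lam \<noteq> 0" "s \<in> {1, - 1}"
  shows "\<exists>U. extends_U lam s U"
proof
  define w where "w = 4 * of_real pi * \<i> * of_real lam"
  define \<sigma> where "\<sigma> x = (if s = 1 then 1 else complex_of_real (sgn x))" for x :: real
  let ?U = "\<lambda>g :: real^2^2. exp (w * of_real (ln \<bar>g $ 1 $ 1\<bar>)) * \<sigma> (g $ 1 $ 1)"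
  have a0: "g $ 1 $ 1 \<noteq> 0" if "g \<in> H_bold lam" for g
    using that by (auto simp: in_H_bold_iff[OF assms(1)])
  have "hilbert_rep (H_bold lam) (\<lambda>g z. ?U g * z)"
    unfolding hilbert_rep_def
  proof (intro conjI ballI allI)
    fix g k assume gk: "g \<in> H_bold lam" "k \<in> H_bold lam"
    then have "(g ** k) $ 1 $ 1 = g $ 1 $ 1 * k $ 1 $ 1"
      by (cases g; cases k) (simp add: mat2_in_H_bold[OF assms(1)])
    moreover have "\<sigma> (x * y) = \<sigma> x * \<sigma> y" for x y by (simp add: \<sigma>_def sgn_mult)
    ultimately have "?U (g ** k) = ?U g * ?U k"
      using a0[OF gk(1)] a0[OF gk(2)] by (simp add: abs_mult ln_mult ring_distribs exp_add)
    then show "(\<lambda>z. ?U (g ** k) * z) = (\<lambda>z. ?U g * z) \<circ> (\<lambda>z. ?U k * z)"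
      by (auto simp: fun_eq_iff)
  next
    show "(\<lambda>z. ?U (mat 1) * z) = id" by (simp add: \<sigma>_def mat_def fun_eq_iff)
  next
    have "continuous_on (H_bold lam) (\<lambda>g. \<sigma> (g $ 1 $ 1))"
      by (cases "s = 1") (auto simp: \<sigma>_def a0 intro!: continuous_intros continuous_on_sgn)
    then show "continuous_on (H_bold lam) (\<lambda>g. ?U g * v)" for v
      by (intro continuous_intros) (auto dest: a0)
  qed (simp_all add: bounded_linear_mult_right scaleC_complex_def)
  moreover have "?U (mexp Z) = exp (2 * pi * \<i> * F_hat lam Z)" if "Z \<in> frak_h" for Z
  proof -
    from that obtain a b where Z: "Z = mat2 a b 0 (- a)" by (rule frak_h_cases)
    moreover obtain y where "mexp Z = mat2 (exp a) y 0 (exp (- a))" using Z mexp_upper_triangular by metis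
    ultimately show ?thesis by (simp add: \<sigma>_def w_def F_hat_eq mult_ac)
  qed
  moreover have "?U epsilon = s"
    using assms(2) by (auto simp: epsilon_def mat_def \<sigma>_def)
  ultimately show "extends_U lam s ?U" unfolding extends_U_def by blast
qed

text \<open>Along a one-parameter group \<open>U\<close> is the exponential of a linear function of \<open>t\<close>, so the differential
  of \<open>U\<close> is \<open>2\<pi>i F_hat\<close>.\<close>

lemma extends_U_derivative:
  assumes "extends_U lam s U" "Z \<in> frak_h"
  shows "((\<lambda>t. U (mexp (t *\<^sub>R Z))) has_vector_derivative 2 * pi * \<i> * F_hat lam Z) (at 0)"
proof -
  obtain a b where Z: "Z = mat2 a b 0 (- a)" using assms(2) by (rule frak_h_cases)
  have "U (mexp (t *\<^sub>R Z)) = exp (t *\<^sub>R (2 * pi * \<i> * F_hat lam Z))" for t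
  proof -
    have t: "t *\<^sub>R Z = mat2 (t * a) (t * b) 0 (- (t * a))" by (simp add: Z)
    then have "U (mexp (t *\<^sub>R Z)) = exp (2 * pi * \<i> * F_hat lam (t *\<^sub>R Z))"
      using assms(1) unfolding extends_U_def by simp
    also have "F_hat lam (t *\<^sub>R Z) = t * F_hat lam Z"
      unfolding t by (simp add: Z F_hat_eq)
    finally show ?thesis by (simp add: scaleR_conv_of_real mult_ac)
  qed
  then show ?thesis
    using exp_scaleR_has_vector_derivative_right[of "2 * pi * \<i> * F_hat lam Z" 0 UNIV] by simp
qed

text \<open>On the positive diagonal matrices, which are exponentials, \<open>U\<close> is the exponential of an imaginary
  number. The others arise from them by \<open>epsilon\<close>, where \<open>U\<close> has the value \<open>s\<close> of modulus \<open>1\<close>.\<close>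

lemma extends_U_unitary_character:
  assumes "lam \<noteq> 0" "s \<in> {1, - 1}" "extends_U lam s U"
  shows "unitary_character (stabilizer SL2 (F_hat lam)) U"
proof -
  let ?G = "stabilizer SL2 (F_hat lam)"
  have rep: "hilbert_rep (H_bold lam) (\<lambda>g z. U g * z)" and eps: "U epsilon = s"
    and U_exp: "\<And>Z. Z \<in> frak_h \<Longrightarrow> U (mexp Z) = exp (2 * pi * \<i> * F_hat lam Z)"
    using assms(3) by (auto simp: extends_U_def)
  have sub: "g \<in> H_bold lam" if "g \<in> ?G" for g
    using that by (cases g) (simp add: mat2_in_stabilizer[OF assms(1)] mat2_in_H_bold[OF assms(1)])
  have mult: "U (g ** k) = U g * U k" if "g \<in> H_bold lam" "k \<in> H_bold lam" for g k
  proof -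
    have "(\<lambda>z. U (g ** k) * z) = (\<lambda>z. U g * z) \<circ> (\<lambda>z. U k * z)"
      using rep that unfolding hilbert_rep_def by blast
    from fun_cong[OF this, of 1] show ?thesis by simp
  qed
  have pos: "norm (U (mat2 a 0 0 d)) = 1" if "0 < a" "a * d = 1" for a d
  proof -
    have "norm (U (mexp (mat2 (ln a) 0 0 (- ln a)))) = 1"
      by (subst U_exp) (simp_all add: norm_exp_eq_Re)
    then show ?thesis using that mexp_ln_diagonal by metis
  qed
  have "norm (U g) = 1" if "g \<in> ?G" for g
  proof -
    from assms(1) that obtain a d where g: "g = mat2 a 0 0 d" and ad: "a * d = 1"
      by (rule stabilizer_cases)
    show ?thesis
    proof (cases "0 < a")
      case True
      then show ?thesis using pos ad g by blast
    next
      case False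
      have e: "epsilon = mat2 (- 1) 0 0 (- 1)" by (simp add: epsilon_def eq_mat2_iff mat_def)
      have "0 < - a" using False ad by (cases "a = 0") auto
      moreover have "U g = U epsilon * U (mat2 (- a) 0 0 (- d))"
        using ad by (subst mult[symmetric]) (simp_all add: e mat2_in_H_bold[OF assms(1)] g)
      ultimately show ?thesis
        using pos[of "- a" "- d"] assms(2) ad by (auto simp: eps norm_mult)
    qed
  qed
  moreover have "continuous_on ?G U"
  proof -
    have "\<forall>v. continuous_on (H_bold lam) (\<lambda>g. U g * v)"
      using rep unfolding hilbert_rep_def by blast
    from spec[OF this, of 1] have "continuous_on (H_bold lam) U" by simp
    then show ?thesis by (rule continuous_on_subset) (use sub in blast)
  qed
  ultimately show ?thesis
    unfolding unitary_character_def using mult sub by blast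
qed

section \<open>The complex polarization\<close>

text \<open>The character \<open>\<chi>\<^sub>F\<close> demanded in the definition is \<open>U\<close> itself, restricted to the stabilizer. Its
  value at \<open>exp Z\<close> is the prescribed one because the Lie algebra of the stabilizer is contained in \<open>\<hh>\<close>.
  The form \<open>\<rho>\<close> respects brackets because it depends on the diagonal only and the bracket of two
  triangular matrices has zero diagonal.\<close>

lemma complex_polarization_eta:
  assumes lam: "lam \<noteq> 0" and s: "s \<in> {1, - 1}"
    and \<rho>: "\<And>Z. Z \<in> eta \<Longrightarrow> \<rho> Z = 2 * pi * \<i> * cext (F_hat lam) Z"
    and U: "extends_U lam s U"
  shows "complex_polarization SL2 (Omega1 lam) (F_hat lam) eta frak_h (\<lambda>g z. U g * z) \<rho>"
proof -
  have rep: "hilbert_rep H_0 (\<lambda>g z. U g * z)"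
    using U hilbert_rep_subset[OF _ H_0_subset_H_bold[OF lam]] by (auto simp: extends_U_def)
  have \<rho>_eta: "\<rho> (mat2 a b 0 (- a)) = 4 * of_real pi * \<i> * of_real lam * a" for a b
    by (simp add: \<rho> cext_F_hat_eta)
  have lie_rep: "one_dim_lie_rep eta \<rho>"
  proof -
    have entry: "\<rho> Z = 4 * of_real pi * \<i> * of_real lam * Z $ 1 $ 1" if "Z \<in> eta" for Z
      using that by (auto simp: \<rho>_eta elim!: eta_cases)
    have closed: "Z + W \<in> eta" "cscale c Z \<in> eta" "bracket Z W \<in> eta" "bracket Z W $ 1 $ 1 = 0"
      "cscale c Z $ 1 $ 1 = c * Z $ 1 $ 1"
      if "Z \<in> eta" "W \<in> eta" for Z W c
      using that by (auto simp: bracket_def elim!: eta_cases)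
    show ?thesis
      unfolding one_dim_lie_rep_def
      by (auto simp: entry closed algebra_simps)
  qed
  have nelson: "nelson_condition frak_h UNIV (\<lambda>Z z. \<rho> (cplx Z) * z)"
  proof (rule nelson_condition_imaginary)
    fix Z assume "Z \<in> frak_h"
    then obtain a b where "Z = mat2 a b 0 (- a)" by (rule frak_h_cases)
    then show "\<rho> (cplx Z) = \<i> * of_real (4 * pi * lam * Z $ 1 $ 1)"
      by (simp add: \<rho>_eta)
  qed
  have gF: "cplx ` lie_algebra (stabilizer SL2 (F_hat lam)) \<subseteq> eta"
    and gF_h: "lie_algebra (stabilizer SL2 (F_hat lam)) \<subseteq> frak_h"
    by (auto elim!: lie_algebra_stabilizer_cases[OF lam])
  have chi: "\<exists>chi. unitary_character (stabilizer SL2 (F_hat lam)) chi \<and>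
      (\<forall>Z\<in>lie_algebra (stabilizer SL2 (F_hat lam)).
         mexp Z \<in> connected_component_set (stabilizer SL2 (F_hat lam)) (mat 1) \<inter> H_0 \<longrightarrow>
           chi (mexp Z) = exp (2 * pi * \<i> * F_hat lam Z)) \<and>
      (\<forall>g \<in> stabilizer SL2 (F_hat lam) \<inter> H_0. \<forall>v. U g * v = chi g *\<^sub>C v)"
    using extends_U_unitary_character[OF lam s U] gF_h U
    by (intro exI[of _ U]) (auto simp: extends_U_def scaleC_complex_def)
  show ?thesis
    unfolding complex_polarization_def Let_def sl2_def[symmetric] sum_conj_eta
      frak_h_def[symmetric] H_0_def[symmetric] H_bold_def[symmetric]
    using linear_lie_group_SL2 coadjoint_orbit_F_hat[OF lam] complex_subalgebra_eta eta_subset gF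
      Ad_stabilizer_eta[OF lam] real_subalgebra_frak_h complexification_frak_h closedin_H_0
      closedin_H_bold[OF lam] irreducible_rep_complex[OF rep] chi lie_rep \<rho> nelson pukanszky
      sl2_functional_in_dual[of "2 * lam" 0 0, folded F_hat_eq]
    by (simp add: complexification_frak_h)
qed

theorem proposition3p1:
  fixes lam :: real and s :: complex and \<rho> :: "complex^2^2 \<Rightarrow> complex"
  assumes "lam \<noteq> 0" and "s \<in> {1, -1}"
    and "\<And>Z. Z \<in> eta \<Longrightarrow> \<rho> Z = 2 * pi * \<i> * cext (F_hat lam) Z"
  shows "H_bold lam = H_0 \<union> (\<lambda>g. epsilon ** g) ` H_0 \<and>
    (\<exists>U. extends_U lam s U) \<and>
    (\<forall>U. extends_U lam s U \<longrightarrow>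
      (\<forall>Z\<in>frak_h. ((\<lambda>t. U (mexp (t *\<^sub>R Z))) has_vector_derivative \<rho> (cplx Z)) (at 0)) \<and>
      complex_polarization SL2 (Omega1 lam) (F_hat lam) eta frak_h (\<lambda>g z. U g * z) \<rho>)"
proof (intro conjI allI impI ballI)
  fix U Z assume U: "extends_U lam s U" and Z: "Z \<in> frak_h"
  then obtain a b where ab: "Z = mat2 a b 0 (- a)" by (metis frak_h_cases)
  have "\<rho> (cplx Z) = 2 * pi * \<i> * F_hat lam Z"
    using cext_F_hat_eta[of lam a b] by (simp add: ab assms(3)) (simp add: F_hat_eq)
  then show "((\<lambda>t. U (mexp (t *\<^sub>R Z))) has_vector_derivative \<rho> (cplx Z)) (at 0)"
    using extends_U_derivative[OF U Z] by simp
qed (use assms H_bold_eq extends_U_exists complex_polarization_eta in blast)+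

end
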